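(* Let $T:E\to X$ be a bounded linear operator from a Banach lattice $E$ into a Banach space $X$. Then $T$ is a $DW$-limited operator if and only if $T$ is both a weak$^*$ Dunford-Pettis operator and an order limited operator.
   Context: All Banach spaces and Banach lattices are real; $X'$ is the topological dual of $X$. For a subset $A$ of a Banach lattice $E$, $Sol(A)=\{y\in E: |y|\le |x| \text{ for some } x\in A\}$. A sequence $(x_n)$ in $E$ is disjoint if $|x_n|\wedge|x_m|=0$ for $n\ne m$. A bounded subset $A$ of $E$ is disjointly weakly compact if every disjoint sequence in $Sol(A)$ converges weakly to zero. A bounded subset $A$ of a Banach space $X$ is a limited set if $\sup_{x\in A}|f_n(x)|\to 0$ for every weak$^*$-null sequence $(f_n)$ in $X'$. A bounded linear operator $T:E\to X$ is: $DW$-limited if $T(A)$ is a limited set for each disjointly weakly compact subset $A$ of $E$; weak$^*$ Dunford-Pettis if $f_n(Tx_n)\to 0$ whenever $x_n\to 0$ weakly in $E$ and $f_n\to 0$ weak$^*$ in $X'$; order limited if $T$ maps order bounded subsets of $E$ to limited subsets of $X$. *)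

theory Defs
  imports "HOL-Analysis.Analysis" "HOL-Library.Lattice_Algebras"
begin

text \<open>Real Banach lattices. The modulus is \<open>\<bar>x\<bar> = sup x (- x)\<close> (lemma \<open>abs_lattice\<close>); the topology
  is the norm topology, with no relation to the order topology assumed.\<close>

class banach_lattice = banach + ordered_real_vector + lattice_ab_group_add_abs +
  assumes norm_mono_abs: "\<bar>x\<bar> \<le> \<bar>y\<bar> \<Longrightarrow> norm x \<le> norm y"

text \<open>The topological dual of \<open>'a\<close> is the type \<open>'a \<Rightarrow>\<^sub>L real\<close>.\<close>

definition weakly_null :: "(nat \<Rightarrow> 'a::real_normed_vector) \<Rightarrow> bool" where
  "weakly_null x \<longleftrightarrow> (\<forall>f :: 'a \<Rightarrow>\<^sub>L real. (\<lambda>n. blinfun_apply f (x n)) \<longlonglongrightarrow> 0)"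

definition weak_star_null :: "(nat \<Rightarrow> ('a::real_normed_vector \<Rightarrow>\<^sub>L real)) \<Rightarrow> bool" where
  "weak_star_null f \<longleftrightarrow> (\<forall>x. (\<lambda>n. blinfun_apply (f n) x) \<longlonglongrightarrow> 0)"

text \<open>On the dual, the library's strong operator topology is the weak* topology.\<close>

lemma weak_star_null_iff_limitin:
  "weak_star_null f \<longleftrightarrow> limitin strong_operator_topology f 0 sequentially"
proof -
  have "limitin strong_operator_topology f 0 sequentially \<longleftrightarrow>
      ((\<lambda>n. blinfun_apply (f n)) \<longlonglongrightarrow> blinfun_apply 0)"
    by (auto simp: limitin_def strong_operator_topology_def openin_pullback_topology
        topspace_pullback_topology tendsto_def)
  also have "\<dots> \<longleftrightarrow> weak_star_null f"
    unfolding limitin_canonical_iff[symmetric] euclidean_product_topology[symmetric]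
    by (simp add: limitin_componentwise weak_star_null_def)
  finally show ?thesis by simp
qed

definition Sol :: "'a::banach_lattice set \<Rightarrow> 'a set" where
  "Sol A = {y. \<exists>x\<in>A. \<bar>y\<bar> \<le> \<bar>x\<bar>}"

definition disjoint_seq :: "(nat \<Rightarrow> 'a::banach_lattice) \<Rightarrow> bool" where
  "disjoint_seq x \<longleftrightarrow> (\<forall>m n. m \<noteq> n \<longrightarrow> inf \<bar>x n\<bar> \<bar>x m\<bar> = 0)"

definition disjointly_weakly_compact :: "'a::banach_lattice set \<Rightarrow> bool" where
  "disjointly_weakly_compact A \<longleftrightarrow>
    bounded A \<and> (\<forall>x. disjoint_seq x \<and> range x \<subseteq> Sol A \<longrightarrow> weakly_null x)"

text \<open>The supremum is taken in \<open>[0,\<infinity>]\<close>, so that it is \<open>0\<close> for the empty set, whereas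
  \<open>Sup {}\<close> is unspecified on \<open>real\<close>.\<close>

definition limited_set :: "'a::real_normed_vector set \<Rightarrow> bool" where
  "limited_set A \<longleftrightarrow> bounded A \<and>
    (\<forall>f. weak_star_null f \<longrightarrow> (\<lambda>n. SUP x\<in>A. ennreal \<bar>blinfun_apply (f n) x\<bar>) \<longlonglongrightarrow> 0)"

definition order_bounded :: "'a::banach_lattice set \<Rightarrow> bool" where
  "order_bounded A \<longleftrightarrow> (\<exists>a b. A \<subseteq> {a..b})"

definition DW_limited :: "('a::banach_lattice \<Rightarrow>\<^sub>L 'b::banach) \<Rightarrow> bool" where
  "DW_limited T \<longleftrightarrow>
    (\<forall>A. disjointly_weakly_compact A \<longrightarrow> limited_set (blinfun_apply T ` A))"

definition weak_star_Dunford_Pettis :: "('a::banach_lattice \<Rightarrow>\<^sub>L 'b::banach) \<Rightarrow> bool" where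
  "weak_star_Dunford_Pettis T \<longleftrightarrow>
    (\<forall>x f. weakly_null x \<and> weak_star_null f \<longrightarrow>
      (\<lambda>n. blinfun_apply (f n) (blinfun_apply T (x n))) \<longlonglongrightarrow> 0)"

definition order_limited :: "('a::banach_lattice \<Rightarrow>\<^sub>L 'b::banach) \<Rightarrow> bool" where
  "order_limited T \<longleftrightarrow>
    (\<forall>A. order_bounded A \<longrightarrow> limited_set (blinfun_apply T ` A))"

end

theory Submission
  imports Defs
begin

text \<open>
  Order bounded sets are disjointly weakly compact, because \<open>\<Sum> \<bar>f (z k)\<bar> \<le> \<parallel>f\<parallel> \<parallel>u\<parallel>\<close> for disjoint \<open>z k\<close>
  with \<open>\<bar>z k\<bar> \<le> u\<close>; so are weakly null sequences \<open>x\<close>: if \<open>y k\<close> is disjoint, \<open>\<bar>y k\<bar> \<le> \<bar>x (\<nu> k)\<bar>\<close>, then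
  \<open>\<bar>f\<bar>\<close> restricted to the principal ideal of \<open>y k\<close> is a seminorm, which at \<open>x (\<nu> k)\<close> is attained by a
  functional \<open>g k\<close> dominated by it. These functionals form an operator into \<open>\<ell>\<^sup>1\<close>, so the Schur property gives
  \<open>\<bar>f (y k)\<bar> \<le> g k (x (\<nu> k)) \<longlonglongrightarrow> 0\<close>. Hence a DW-limited operator has both properties.

  Conversely, for a disjointly weakly compact set \<open>A\<close> and the functionals \<open>\<phi> n = f n \<circ> T\<close>, a disjointification
  splits a suitable subsequence of any sequence in \<open>A\<close> into a disjoint part in \<open>Sol A\<close>, on which the \<open>\<phi> n\<close> tend
  to zero by the weak* Dunford-Pettis property, and a remainder controlled by order intervals.
\<close>

subsection \<open>Disjointness in lattice-ordered groups\<close>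

text \<open>With \<open>c = a - b\<close>, the positive part of \<open>c\<close> is \<open>c\<close>
  plus its negative part. Translating by the negative part reduces the claim to
  \<open>inf c 0\<close> being the opposite of the negative part.\<close>

lemma pos_part_neg_part_disjoint:
  fixes a b :: "'a::lattice_ab_group_add"
  shows "inf (sup (a - b) 0) (sup (b - a) 0) = 0"
proof -
  have "sup (a - b) 0 = (a - b) + sup 0 (b - a)"
    by (simp add: add_sup_distrib_left)
  then have "inf (sup (a - b) 0) (sup (b - a) 0) = inf ((a - b) + sup (b - a) 0) (0 + sup (b - a) 0)"
    by (simp add: sup_commute)
  also have "\<dots> = inf (a - b) 0 + sup (b - a) 0"
    by (simp only: add_inf_distrib_right)
  also have "inf (a - b) 0 = - sup (b - a) 0"
    by simp
  finally show ?thesis by (simp only: left_minus)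
qed

text \<open>Distributivity turns the right side into the infimum of \<open>a + b\<close>,
  \<open>c + b\<close>, \<open>a + c\<close> and \<open>c + c\<close>, each of which dominates the
  left side.\<close>

lemma inf_add_nonneg:
  fixes a b c :: "'a::lattice_ab_group_add"
  assumes "0 \<le> a" "0 \<le> b" "0 \<le> c"
  shows "inf (a + b) c \<le> inf a c + inf b c"
proof -
  have "inf a c + inf b c = inf (inf (a + b) (c + b)) (inf (a + c) (c + c))"
    by (simp add: add_inf_distrib_left add_inf_distrib_right inf_aci)
  moreover have "inf (a + b) c \<le> c + b" "inf (a + b) c \<le> a + c" "inf (a + b) c \<le> c + c"
    using assms by (meson add_increasing add_increasing2 inf.coboundedI2 order_refl)+
  ultimately show ?thesis by simp
qed

text \<open>Since \<open>a + b = inf a b + sup a b\<close>, a sum of two disjoint elements is their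
  supremum.\<close>

lemma sum_disjoint_le:
  fixes a :: "nat \<Rightarrow> 'a::lattice_ab_group_add"
  assumes "\<And>i. i < n \<Longrightarrow> 0 \<le> a i" "\<And>i. i < n \<Longrightarrow> a i \<le> u" "0 \<le> u"
    and "\<And>i j. i < j \<Longrightarrow> j < n \<Longrightarrow> inf (a i) (a j) = 0"
  shows "(\<Sum>i<n. a i) \<le> u"
  using assms
proof (induction n)
  case (Suc n)
  \<comment> \<open>Every partial sum stays disjoint from the new term, by subadditivity of
    \<open>inf\<close> on nonnegative elements.\<close>
  have "inf (\<Sum>i<m. a i) (a n) = 0" if "m \<le> n" for m
    using that
  proof (induction m)
    case (Suc m)
    have "inf (sum a {..<m} + a m) (a n) \<le> inf (sum a {..<m}) (a n) + inf (a m) (a n)"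
      using Suc.prems \<open>\<And>i. i < Suc n \<Longrightarrow> 0 \<le> a i\<close> by (intro inf_add_nonneg sum_nonneg) auto
    also have "\<dots> = 0"
      using Suc \<open>\<And>i j. i < j \<Longrightarrow> j < Suc n \<Longrightarrow> inf (a i) (a j) = 0\<close>[of m n] by auto
    finally show ?case
      using Suc.prems \<open>\<And>i. i < Suc n \<Longrightarrow> 0 \<le> a i\<close>
      by (intro antisym) (auto intro!: add_nonneg_nonneg sum_nonneg)
  qed (use Suc.prems in \<open>auto simp: inf_absorb1\<close>)
  then have "(\<Sum>i<Suc n. a i) = sup (\<Sum>i<n. a i) (a n)"
    using add_eq_inf_sup[of "\<Sum>i<n. a i" "a n"] by simp
  also have "\<dots> \<le> u"
    using Suc by (intro le_supI) auto
  finally show ?case .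
qed simp

text \<open>The part \<open>a\<close> is the truncation of \<open>x\<close> to
  \<open>[-u, u]\<close>. The bounds by \<open>|x|\<close> keep both parts in every ideal or solid
  set that contains \<open>x\<close>.\<close>

lemma Riesz_decomposition:
  fixes x u v :: "'a::lattice_ab_group_add_abs"
  assumes "0 \<le> u" "0 \<le> v" "\<bar>x\<bar> \<le> u + v"
  obtains a b where "x = a + b" "\<bar>a\<bar> \<le> u" "\<bar>b\<bar> \<le> v" "\<bar>a\<bar> \<le> \<bar>x\<bar>" "\<bar>b\<bar> \<le> \<bar>x\<bar>"
proof -
  define a where "a = sup (- u) (inf x u)"
  have x: "x \<le> u + v" "- x \<le> u + v" "x \<le> \<bar>x\<bar>" "- x \<le> \<bar>x\<bar>" "0 \<le> \<bar>x\<bar>"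
    using assms(3) abs_le_D1 abs_le_D2 by (auto simp: abs_ge_self abs_ge_minus_self)
  have xm: "- \<bar>x\<bar> \<le> x" "- (u + v) \<le> x"
    using x(2,4) by (simp_all only: minus_le_iff)
  have u: "- u \<le> 0" using assms(1) by simp
  \<comment> \<open>One criterion serves the bounds \<open>w = u\<close> and \<open>w = |x|\<close>;
    its counterpart for \<open>x - a\<close> serves \<open>v\<close> and \<open>|x|\<close>.\<close>
  have a: "\<bar>a\<bar> \<le> w" if "0 \<le> w" "inf x u \<le> w" "- w \<le> a" for w
  proof (rule abs_leI)
    show "a \<le> w"
      unfolding a_def using order.trans[OF u that(1)] that(2) by (rule le_supI)
    show "- a \<le> w"
      using that(3) by (simp only: minus_le_iff)
  qed
  have a1: "\<bar>a\<bar> \<le> u"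
    by (rule a) (use assms(1) in \<open>auto simp: a_def\<close>)
  have a2: "\<bar>a\<bar> \<le> \<bar>x\<bar>"
  proof (rule a)
    show "inf x u \<le> \<bar>x\<bar>" using x(3) by (rule le_infI1)
    have "- \<bar>x\<bar> \<le> u" using x(5) assms(1) by (meson neg_le_0_iff_le order.trans)
    with xm(1) show "- \<bar>x\<bar> \<le> a" unfolding a_def by (intro le_supI2 le_infI)
  qed (rule x)
  have ba: "x - a = inf (x + u) (sup 0 (x - u))"
    unfolding a_def by (simp add: add_sup_distrib_left add_inf_distrib_left)
  have b: "\<bar>x - a\<bar> \<le> w" if "0 \<le> w" "x - u \<le> w" "- w \<le> x + u" for w
  proof (rule abs_leI)
    show "x - a \<le> w"
      unfolding ba using that by (auto intro: le_infI2)
    have "- w \<le> 0" using that by simp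
    then have "- w \<le> inf (x + u) (sup 0 (x - u))"
      using that by (auto intro: le_supI1)
    then show "- (x - a) \<le> w"
      unfolding ba[symmetric] by (simp only: minus_le_iff)
  qed
  show thesis
  proof (rule that[of a "x - a"])
    have "- v \<le> x + u"
      using add_right_mono[OF xm(2), of u] by simp
    moreover have "x - u \<le> v"
      using x(1) by (simp add: algebra_simps)
    ultimately show "\<bar>x - a\<bar> \<le> v"
      using assms(2) by (intro b)
    have "- \<bar>x\<bar> \<le> x + u"
      using add_mono[OF xm(1) assms(1)] by simp
    moreover have "x - u \<le> \<bar>x\<bar>"
      using add_mono[OF x(3) u] by simp
    ultimately show "\<bar>x - a\<bar> \<le> \<bar>x\<bar>"
      using x(5) by (intro b)
  qed (use a1 a2 in auto)
qed

subsection \<open>The Hahn--Banach theorem\<close>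

definition sublinear :: "('a::real_vector \<Rightarrow> real) \<Rightarrow> bool" where
  "sublinear p \<longleftrightarrow> (\<forall>x y. p (x + y) \<le> p x + p y) \<and> (\<forall>c x. 0 \<le> c \<longrightarrow> p (c *\<^sub>R x) = c * p x)"

text \<open>Equality for positive scalars follows from the inequality applied to
  \<open>inverse c\<close> as well.\<close>

lemma sublinearI:
  assumes add: "\<And>x y. p (x + y) \<le> p x + p y"
    and zero: "p 0 \<le> 0"
    and scale: "\<And>c x. 0 < c \<Longrightarrow> p (c *\<^sub>R x) \<le> c * p x"
  shows "sublinear p"
proof -
  have "p (c *\<^sub>R x) = c * p x" if "0 \<le> c" for c x
  proof (cases "c = 0")
    case True
    then show ?thesis using zero add[of 0 0] by simp
  next
    case False
    then have "p x \<le> inverse c * p (c *\<^sub>R x)"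
      using that scale[of "inverse c" "c *\<^sub>R x"] by simp
    then show ?thesis
      using that False scale[of c x] by (intro antisym) (auto simp: field_simps)
  qed
  then show ?thesis
    using add by (auto simp: sublinear_def)
qed

lemma
  assumes "sublinear p"
  shows sublinear_add: "p (x + y) \<le> p x + p y"
    and sublinear_scaleR: "0 \<le> c \<Longrightarrow> p (c *\<^sub>R x) = c * p x"
    and sublinear_zero: "p 0 = 0"
    and sublinear_minus: "- p (- x) \<le> p x"
proof -
  show "p (x + y) \<le> p x + p y" "0 \<le> c \<Longrightarrow> p (c *\<^sub>R x) = c * p x" for x y c
    using assms by (auto simp: sublinear_def)
  from this(2)[of 0 0] show *: "p 0 = 0" by simp
  show "- p (- x) \<le> p x"
    using assms * unfolding sublinear_def by (metis add.right_inverse neg_le_iff_le add.commute diff_0 diff_le_eq)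
qed

text \<open>Take the infimum over \<open>t \<ge> 0\<close> of \<open>p (x + t y) - t p y\<close>:
  the parameter \<open>t = 0\<close> gives \<open>q \<le> p\<close>, and \<open>t = 1\<close> gives
  the value at \<open>- y\<close>. It follows that minimal sublinear functionals are odd.\<close>

lemma sublinear_odd_minorant:
  fixes p :: "'a::real_vector \<Rightarrow> real"
  assumes p: "sublinear p"
  obtains q where "sublinear q" "\<And>x. q x \<le> p x" "q (- y) \<le> - p y"
proof -
  define S where "S x = (\<lambda>t. p (x + t *\<^sub>R y) - t * p y) ` {0..}" for x
  define q where "q x = Inf (S x)" for x
  have bdd: "bdd_below (S x)" for x
    unfolding S_def
  proof (rule bdd_belowI2)
    fix t :: real assume "t \<in> {0..}"
    then show "- p (- x) \<le> p (x + t *\<^sub>R y) - t * p y"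
      using sublinear_add[OF p, of "- x" "x + t *\<^sub>R y"] sublinear_scaleR[OF p, of t y] by simp
  qed
  have low: "q x \<le> p (x + t *\<^sub>R y) - t * p y" if "0 \<le> t" for x t
    unfolding q_def using that by (intro cInf_lower bdd) (auto simp: S_def)
  have great: "c \<le> q x" if "\<And>t. 0 \<le> t \<Longrightarrow> c \<le> p (x + t *\<^sub>R y) - t * p y" for c x
    unfolding q_def using that by (intro cInf_greatest) (auto simp: S_def)
  have "sublinear q"
  proof (rule sublinearI)
    show "q 0 \<le> 0"
      using low[of 0 0] sublinear_zero[OF p] by simp
    fix x z
    \<comment> \<open>Parameters \<open>s\<close> for \<open>x\<close> and \<open>t\<close> for
      \<open>z\<close> combine to \<open>s + t\<close> for \<open>x + z\<close>; the two infima are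
      then taken one after the other.\<close>
    have "q (x + z) - (p (x + s *\<^sub>R y) - s * p y) \<le> p (z + t *\<^sub>R y) - t * p y"
      if "0 \<le> s" "0 \<le> t" for s t
      using low[of "s + t" "x + z"] sublinear_add[OF p, of "x + s *\<^sub>R y" "z + t *\<^sub>R y"] that
      by (simp add: algebra_simps)
    then have "q (x + z) - (p (x + s *\<^sub>R y) - s * p y) \<le> q z" if "0 \<le> s" for s
      using that by (intro great) auto
    then have "q (x + z) - q z \<le> q x"
      by (intro great) (auto simp: algebra_simps)
    then show "q (x + z) \<le> q x + q z" by simp
  next
    fix c :: real and x assume c: "0 < c"
    have "q (c *\<^sub>R x) / c \<le> q x"
    proof (rule great)
      fix t :: real assume "0 \<le> t"
      then have "q (c *\<^sub>R x) \<le> c * (p (x + t *\<^sub>R y) - t * p y)"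
        using low[of "c * t" "c *\<^sub>R x"] c sublinear_scaleR[OF p, of c "x + t *\<^sub>R y"]
        by (simp add: algebra_simps)
      then show "q (c *\<^sub>R x) / c \<le> p (x + t *\<^sub>R y) - t * p y"
        using c by (simp add: field_simps)
    qed
    then show "q (c *\<^sub>R x) \<le> c * q x"
      using c by (simp add: field_simps)
  qed
  then show thesis
    using low[of 0] low[of 1 "- y"] sublinear_zero[OF p] by (intro that) auto
qed

text \<open>The linear functionals are exactly the minimal sublinear ones.\<close>

lemma Hahn_Banach_sublinear:
  fixes p :: "'a::real_vector \<Rightarrow> real"
  assumes p: "sublinear p"
  obtains g where "linear g" "\<And>x. g x \<le> p x" "g y = p y"
proof -
  \<comment> \<open>Staying below \<open>p1\<close> rather than \<open>p\<close> secures the value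
    at \<open>y\<close>: a linear \<open>g \<le> p1\<close> has
    \<open>- g y = g (- y) \<le> - p y\<close>.\<close>
  obtain p1 where p1: "sublinear p1" "\<And>x. p1 x \<le> p x" "p1 (- y) \<le> - p y"
    using sublinear_odd_minorant[OF p, of y] by blast
  define A where "A = {q. sublinear q \<and> (\<forall>x. q x \<le> p1 x)}"
  \<comment> \<open>Zorn's lemma for the reversed pointwise order yields a minimal element; a
    nonempty chain is bounded below by its pointwise infimum.\<close>
  have "\<exists>m\<in>A. \<forall>a\<in>A. a \<le> m \<longrightarrow> a = m"
  proof (rule predicate_Zorn[where P = "\<lambda>a b. b \<le> a"])
    show "partial_order_on A (relation_of (\<lambda>a b. b \<le> a) A)"
      by (rule partial_order_on_relation_ofI) auto
    fix C assume "C \<in> Chains (relation_of (\<lambda>a b. b \<le> a) A)"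
    then have C: "C \<subseteq> A" "\<And>a b. a \<in> C \<Longrightarrow> b \<in> C \<Longrightarrow> a \<le> b \<or> b \<le> a"
      by (auto simp: Chains_def relation_of_def)
    show "\<exists>u\<in>A. \<forall>a\<in>C. u \<le> a"
    proof (cases "C = {}")
      case True
      then show ?thesis using p1 by (auto simp: A_def)
    next
      case False
      define q where "q x = (INF a\<in>C. a x)" for x
      have bdd: "bdd_below ((\<lambda>a. a x) ` C)" for x
      proof (rule bdd_belowI2)
        fix a assume "a \<in> C"
        then have "sublinear a" "a (- x) \<le> p1 (- x)" using C by (auto simp: A_def)
        then show "- p1 (- x) \<le> a x" using sublinear_minus[of a x] by simp
      qed
      have low: "q x \<le> a x" if "a \<in> C" for a x
        unfolding q_def using that bdd by (intro cINF_lower) auto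
      have great: "c \<le> q x" if "\<And>a. a \<in> C \<Longrightarrow> c \<le> a x" for c x
        unfolding q_def using that False by (intro cINF_greatest) auto
      obtain a0 where a0: "a0 \<in> C" using False by auto
      have sub: "sublinear a" if "a \<in> C" for a using that C by (auto simp: A_def)
      have "sublinear q"
      proof (rule sublinearI)
        show "q 0 \<le> 0" using low[OF a0, of 0] sublinear_zero[OF sub[OF a0]] by simp
        fix x z
        have "q (x + z) - a x \<le> b z" if "a \<in> C" "b \<in> C" for a b
        proof -
          \<comment> \<open>Of two members of a chain the smaller one lies below both, so
            subadditivity of that single functional suffices.\<close>
          have "\<exists>c\<in>C. c \<le> a \<and> c \<le> b"
            using C(2)[OF that] that by blast
          then obtain c where c: "c \<in> C" "c \<le> a" "c \<le> b" by blast
          have "q (x + z) \<le> c x + c z"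
            using low[OF c(1), of "x + z"] sublinear_add[OF sub[OF c(1)], of x z] by simp
          then show ?thesis
            using c(2,3) by (smt (verit) le_funD)
        qed
        then have "q (x + z) - a x \<le> q z" if "a \<in> C" for a
          using that by (intro great) auto
        then have "q (x + z) - q z \<le> q x"
          by (intro great) (auto simp: algebra_simps)
        then show "q (x + z) \<le> q x + q z" by simp
      next
        fix c :: real and x assume c: "0 < c"
        have "q (c *\<^sub>R x) / c \<le> q x"
        proof (rule great)
          fix a assume "a \<in> C"
          then show "q (c *\<^sub>R x) / c \<le> a x"
            using low[of a "c *\<^sub>R x"] sublinear_scaleR[OF sub, of a c x] c by (simp add: field_simps)
        qed
        then show "q (c *\<^sub>R x) \<le> c * q x" using c by (simp add: field_simps)
      qed
      moreover have "q x \<le> p1 x" for x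
        using low[OF a0, of x] a0 C by (auto simp: A_def intro: order.trans)
      ultimately show ?thesis
        using low by (intro bexI[of _ q]) (auto simp: A_def le_fun_def)
    qed
  qed
  then obtain g where "g \<in> A" and g_min: "\<And>q. q \<in> A \<Longrightarrow> q \<le> g \<Longrightarrow> q = g"
    by blast
  then have g: "sublinear g" "\<And>x. g x \<le> p1 x"
    by (auto simp: A_def)
  have min: "q = g" if "sublinear q" "\<And>x. q x \<le> g x" for q
    using that order.trans[OF that(2) g(2)] by (intro g_min) (auto simp: A_def le_fun_def)
  \<comment> \<open>By minimality \<open>g\<close> coincides with its own odd minorant in the
    direction \<open>z\<close>.\<close>
  have odd: "g (- z) = - g z" for z
  proof -
    obtain q where q: "sublinear q" "\<And>x. q x \<le> g x" "q (- z) \<le> - g z"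
      using sublinear_odd_minorant[OF g(1), of z] by blast
    then have "q = g" using min by blast
    then show ?thesis using q(3) sublinear_minus[OF g(1), of z] by simp
  qed
  have "linear g"
  proof (rule linearI)
    fix x z
    show "g (x + z) = g x + g z"
      using sublinear_add[OF g(1), of x z] sublinear_add[OF g(1), of "x + z" "- z"]
        odd[of z] by simp
    fix c :: real
    show "g (c *\<^sub>R x) = c *\<^sub>R g x"
      using sublinear_scaleR[OF g(1), of c x] sublinear_scaleR[OF g(1), of "- c" x]
        odd[of "c *\<^sub>R x"]
      by (cases "0 \<le> c") auto
  qed
  moreover have "g x \<le> p x" for x
    using g(2) p1(2) by (rule order.trans)
  moreover have "p y \<le> g y"
    using g(2)[of "- y"] p1(3) odd[of y] by simp
  ultimately show thesis
    by (metis that antisym)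
qed

text \<open>Evenness of \<open>p\<close> turns the one-sided bound on \<open>g\<close> into a bound
  on \<open>|g|\<close>, and the bound by the norm makes \<open>g\<close> continuous.\<close>

lemma Hahn_Banach_seminorm:
  fixes p :: "'a::real_normed_vector \<Rightarrow> real"
  assumes "sublinear p" and p_minus: "\<And>x. p (- x) = p x" and p_le: "\<And>x. p x \<le> C * norm x"
  obtains g :: "'a \<Rightarrow>\<^sub>L real" where "\<And>x. \<bar>g x\<bar> \<le> p x" "g y = p y"
proof -
  obtain g where g: "linear g" "\<And>x. g x \<le> p x" "g y = p y"
    using Hahn_Banach_sublinear[OF assms(1), of y] by blast
  have abs: "\<bar>g x\<bar> \<le> p x" for x
    using g(2)[of x] g(2)[of "- x"] linear_neg[OF g(1), of x] p_minus[of x] by simp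
  have "norm (g x) \<le> norm x * C" for x
    using order.trans[OF abs p_le, of x] by (simp add: mult.commute)
  then have "bounded_linear g"
    using g(1) by (intro bounded_linear_intro) (auto simp: linear_add linear_scale)
  then show thesis
    using abs g(3) by (intro that[of "Blinfun g"]) (auto simp: bounded_linear_Blinfun_apply)
qed

lemma norming_functional:
  fixes y :: "'a::real_normed_vector"
  obtains g :: "'a \<Rightarrow>\<^sub>L real" where "\<And>x. \<bar>g x\<bar> \<le> norm x" "g y = norm y"
proof -
  have "sublinear (norm :: 'a \<Rightarrow> real)"
    by (rule sublinearI) (auto intro: norm_triangle_ineq)
  then show thesis
    by (rule Hahn_Banach_seminorm[of norm 1 y]) (auto intro: that)
qed

subsection \<open>Weakly null sequences\<close>

text \<open>Uniform boundedness by Baire category: the closed sets \<open>F m\<close> cover the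
  dual, so one of them contains a ball.\<close>

lemma weakly_null_bounded:
  fixes x :: "nat \<Rightarrow> 'a::real_normed_vector"
  assumes "weakly_null x"
  shows "bounded (range x)"
proof -
  define F where "F m = {f :: 'a \<Rightarrow>\<^sub>L real. \<forall>n. \<bar>f (x n)\<bar> \<le> real m}" for m :: nat
  have closed: "closed (F m)" for m
    unfolding F_def by (intro closed_Collect_all closed_Collect_le continuous_intros)
  have "f \<in> \<Union> (range F)" for f :: "'a \<Rightarrow>\<^sub>L real"
  proof -
    have "convergent (\<lambda>n. f (x n))"
      using assms by (auto simp: weakly_null_def convergent_def)
    then have "Bseq (\<lambda>n. f (x n))"
      by (rule convergent_imp_Bseq)
    then obtain K where "\<And>n. \<bar>f (x n)\<bar> \<le> K"
      by (auto simp: Bseq_def)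
    moreover obtain m :: nat where "K \<le> real m"
      using real_arch_simple by blast
    ultimately have "f \<in> F m"
      unfolding F_def using order.trans by blast
    then show ?thesis by blast
  qed
  then have "\<Union> (range F) = UNIV"
    by blast
  moreover have "interior (\<Union> (range F)) = {}" if "\<And>m. interior (F m) = {}"
  proof -
    have "euclidean interior_of \<Union> (range F) = {}"
      using closed that
      by (intro Baire_category_alt) (auto simp: completely_metrizable_space_euclidean)
    then show ?thesis by simp
  qed
  ultimately have "\<exists>m. interior (F m) \<noteq> {}"
    by (metis UNIV_not_empty interior_UNIV)
  then obtain m f0 where "f0 \<in> interior (F m)"
    by blast
  then obtain r where r: "0 < r" "cball f0 r \<subseteq> F m"
    by (auto simp: mem_interior_cball)
  \<comment> \<open>With \<open>g\<close> norming \<open>x n\<close>, both \<open>f0\<close> and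
    \<open>f0 + r g\<close> are bounded by \<open>m\<close> at \<open>x n\<close>, hence
    \<open>r\<close> times the norm is at most \<open>2 m\<close>.\<close>
  have "norm (x n) \<le> 2 * real m / r" for n
  proof -
    obtain g :: "'a \<Rightarrow>\<^sub>L real" where g: "\<And>z. \<bar>g z\<bar> \<le> norm z" "g (x n) = norm (x n)"
      using norming_functional[of "x n"] by blast
    have "norm g \<le> 1"
      using g(1) by (intro norm_blinfun_bound) auto
    then have "f0 + r *\<^sub>R g \<in> F m"
      using r by (intro subsetD[OF r(2)]) (auto simp: dist_norm mult_le_cancel_left1)
    moreover have "f0 \<in> F m"
      using r by auto
    ultimately have "\<bar>f0 (x n)\<bar> \<le> real m" "\<bar>f0 (x n) + r * g (x n)\<bar> \<le> real m"
      by (auto simp: F_def blinfun.add_left blinfun.scaleR_left)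
    then show ?thesis
      using r(1) g(2) by (simp add: field_simps)
  qed
  then show ?thesis
    by (auto simp: bounded_iff)
qed

text \<open>Combines the functionals selected by the gliding hump into one element of the
  dual.\<close>

lemma bounded_linear_suminf:
  fixes h :: "nat \<Rightarrow> 'a::real_normed_vector \<Rightarrow>\<^sub>L real"
  assumes "\<And>n z. (\<Sum>k<n. \<bar>h k z\<bar>) \<le> C * norm z"
  shows "bounded_linear (\<lambda>z. \<Sum>k. h k z)"
proof (rule bounded_linear_intro)
  have abs: "summable (\<lambda>k. \<bar>h k z\<bar>)" for z
    by (rule summableI_nonneg_bounded[OF _ assms]) auto
  then have sum: "summable (\<lambda>k. h k z)" for z
    by (rule summable_rabs_cancel)
  fix x y :: 'a and c :: real
  show "(\<Sum>k. h k (x + y)) = (\<Sum>k. h k x) + (\<Sum>k. h k y)"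
    by (simp add: blinfun.add_right suminf_add sum)
  show "(\<Sum>k. h k (c *\<^sub>R x)) = c *\<^sub>R (\<Sum>k. h k x)"
    by (simp add: blinfun.scaleR_right suminf_mult sum)
  have "(\<Sum>k. \<bar>h k x\<bar>) \<le> C * norm x"
    by (rule suminf_le_const[OF abs assms])
  then show "norm (\<Sum>k. h k x) \<le> norm x * C"
    using summable_rabs[OF abs[of x]] by (simp add: mult.commute)
qed

text \<open>The functionals \<open>g k\<close> form an operator into \<open>\<ell>\<^sup>1\<close>; a weakly null sequence has weakly null,
  hence norm null, image by Schur's theorem. The proof is Schur's gliding hump.\<close>

lemma gliding_hump:
  fixes g :: "nat \<Rightarrow> 'a::real_normed_vector \<Rightarrow>\<^sub>L real" and \<nu> :: "nat \<Rightarrow> nat"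
  assumes x: "weakly_null x" and g: "\<And>n z. (\<Sum>k<n. \<bar>g k z\<bar>) \<le> C * norm z"
  shows "(\<lambda>k. g k (x (\<nu> k))) \<longlonglongrightarrow> 0"
proof (rule ccontr)
  assume "\<not> ?thesis"
  then obtain \<epsilon> where \<epsilon>: "0 < \<epsilon>" and often: "\<And>K. \<exists>k\<ge>K. \<epsilon> \<le> \<bar>g k (x (\<nu> k))\<bar>"
    unfolding LIMSEQ_iff by (auto simp: not_less)
  have abs: "summable (\<lambda>k. \<bar>g k z\<bar>)" for z
    by (rule summableI_nonneg_bounded[OF _ g]) auto
  \<comment> \<open>The next hump \<open>k\<close> after \<open>N\<close>: the functionals up to
    \<open>N\<close> are small on the new vector, and those from \<open>k\<close> on are small on
    the old one. The clause \<open>N \<le> \<nu> k\<close> drives the indices to infinity although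
    \<open>\<nu>\<close> is arbitrary.\<close>
  define R where "R N k \<longleftrightarrow> N < k \<and> N \<le> \<nu> k \<and> (\<Sum>i\<le>N. \<bar>g i (x (\<nu> k))\<bar>) < \<epsilon> / 4 \<and>
    (\<Sum>i. \<bar>g (i + k) (x (\<nu> N))\<bar>) < \<epsilon> / 4" for N k
  have step: "\<exists>k. \<epsilon> \<le> \<bar>g k (x (\<nu> k))\<bar> \<and> R N k" for N
  proof -
    have "(\<lambda>n. \<Sum>i\<le>N. \<bar>g i (x n)\<bar>) \<longlonglongrightarrow> (\<Sum>i\<le>N. \<bar>0\<bar>)"
      using x by (intro tendsto_intros) (auto simp: weakly_null_def)
    then have "\<forall>\<^sub>F n in sequentially. (\<Sum>i\<le>N. \<bar>g i (x n)\<bar>) < \<epsilon> / 4"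
      using \<epsilon> by (intro order_tendstoD) auto
    then obtain m where m: "\<And>n. m \<le> n \<Longrightarrow> (\<Sum>i\<le>N. \<bar>g i (x n)\<bar>) < \<epsilon> / 4"
      by (auto simp: eventually_sequentially)
    have "\<forall>\<^sub>F k in sequentially. \<forall>n\<in>{..<max m N}. \<bar>g k (x n)\<bar> < \<epsilon>"
      using order_tendstoD(2)[OF summable_LIMSEQ_zero[OF abs] \<epsilon>]
      by (intro eventually_ball_finite) auto
    then obtain K where K: "\<And>k n. K \<le> k \<Longrightarrow> n < max m N \<Longrightarrow> \<bar>g k (x n)\<bar> < \<epsilon>"
      by (auto simp: eventually_sequentially)
    obtain M where M: "\<And>k. M \<le> k \<Longrightarrow> norm (\<Sum>i. \<bar>g (i + k) (x (\<nu> N))\<bar>) < \<epsilon> / 4"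
      using suminf_exist_split[OF _ abs] \<epsilon> by (metis zero_less_divide_iff zero_less_numeral)
    obtain k where k: "max K (max M (Suc N)) \<le> k" "\<epsilon> \<le> \<bar>g k (x (\<nu> k))\<bar>"
      using often by blast
    \<comment> \<open>On the finitely many vectors with smaller index \<open>g k\<close> is already
      below \<epsilon>, so the large value at \<open>\<nu> k\<close> rules them out.\<close>
    have "max m N \<le> \<nu> k"
      using K[of k "\<nu> k"] k by (metis max.bounded_iff not_le)
    then have "R N k"
      using k(1) m[of "\<nu> k"] M[of k] by (auto simp: R_def)
    then show ?thesis using k(2) by blast
  qed
  have "\<exists>r. \<forall>n. \<epsilon> \<le> \<bar>g (r n) (x (\<nu> (r n)))\<bar> \<and> R (r n) (r (Suc n))"
    by (rule dependent_nat_choice) (use step in blast)+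
  then obtain r where r: "\<And>n. \<epsilon> \<le> \<bar>g (r n) (x (\<nu> (r n)))\<bar>" "\<And>n. R (r n) (r (Suc n))"
    by blast
  have "strict_mono r"
    using r(2) by (simp add: strict_mono_Suc_iff R_def)
  \<comment> \<open>Only the selected functionals are kept, so nothing is summed between consecutive
    humps.\<close>
  define h where "h k = (if k \<in> range r then g k else 0)" for k
  have h_le: "\<bar>h k z\<bar> \<le> \<bar>g k z\<bar>" for k z
    by (simp add: h_def)
  have h_bound: "(\<Sum>k<n. \<bar>h k z\<bar>) \<le> C * norm z" for n z
    using g[of z n] sum_mono[of "{..<n}" "\<lambda>k. \<bar>h k z\<bar>" "\<lambda>k. \<bar>g k z\<bar>"] h_le by fastforce
  have h_abs: "summable (\<lambda>k. \<bar>h k z\<bar>)" for z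
    by (rule summableI_nonneg_bounded[OF _ h_bound]) auto
  define G where "G = Blinfun (\<lambda>z. \<Sum>k. h k z)"
  have G: "G z = (\<Sum>k. h k z)" for z
    unfolding G_def by (simp add: bounded_linear_Blinfun_apply bounded_linear_suminf[OF h_bound])
  have hump: "\<epsilon> / 2 \<le> \<bar>G (x (\<nu> (r (Suc n))))\<bar>" for n
  proof -
    let ?w = "x (\<nu> (r (Suc n)))" and ?k = "r (Suc n)" and ?l = "r (Suc (Suc n))"
    have lt: "r n < ?k" "?k < ?l"
      using \<open>strict_mono r\<close> by (auto simp: strict_mono_less)
    have gap: "h i = 0" if "i < ?l" "r n < i" "i \<noteq> ?k" for i
    proof -
      have "j = Suc n" if "i = r j" for j
        using \<open>i < ?l\<close> \<open>r n < i\<close> that \<open>strict_mono r\<close> by (simp add: strict_mono_less)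
      then show ?thesis using \<open>i \<noteq> ?k\<close> by (auto simp: h_def)
    qed
    \<comment> \<open>Tail, hump and head: the hump is at least \<epsilon>, the other two are below
      \<open>\<epsilon> / 4\<close>. The head estimate needs a predecessor, whence
      \<open>Suc n\<close>.\<close>
    have "G ?w = (\<Sum>i. h (i + ?l) ?w) + (\<Sum>i<?l. h i ?w)"
      unfolding G using summable_rabs_cancel[OF h_abs] by (rule suminf_split_initial_segment)
    also have "(\<Sum>i<?l. h i ?w) = (\<Sum>i\<in>insert ?k {..r n}. h i ?w)"
      using lt gap by (intro sum.mono_neutral_right) (auto simp: not_le)
    also have "\<dots> = g ?k ?w + (\<Sum>i\<le>r n. h i ?w)"
      using lt by (simp add: h_def)
    finally have "\<bar>g ?k ?w\<bar> \<le> \<bar>G ?w\<bar> + \<bar>\<Sum>i. h (i + ?l) ?w\<bar> + \<bar>\<Sum>i\<le>r n. h i ?w\<bar>"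
      by linarith
    moreover have "\<bar>\<Sum>i\<le>r n. h i ?w\<bar> \<le> (\<Sum>i\<le>r n. \<bar>g i ?w\<bar>)"
      by (rule order.trans[OF sum_abs sum_mono[OF h_le]])
    moreover have "\<bar>\<Sum>i. h (i + ?l) ?w\<bar> \<le> (\<Sum>i. \<bar>g (i + ?l) ?w\<bar>)"
    proof -
      have "\<bar>\<Sum>i. h (i + ?l) ?w\<bar> \<le> (\<Sum>i. \<bar>h (i + ?l) ?w\<bar>)"
        using h_abs[of ?w] by (intro summable_rabs) (rule summable_ignore_initial_segment)
      also have "\<dots> \<le> (\<Sum>i. \<bar>g (i + ?l) ?w\<bar>)"
        using h_abs[of ?w] abs[of ?w]
        by (intro suminf_le h_le) (auto intro: summable_ignore_initial_segment)
      finally show ?thesis .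
    qed
    ultimately show ?thesis
      using r(1)[of "Suc n"] r(2)[of n] r(2)[of "Suc n"] \<epsilon> by (simp add: R_def)
  qed
  have "(\<lambda>n. G (x n)) \<longlonglongrightarrow> 0"
    using x by (auto simp: weakly_null_def)
  then have "\<forall>\<^sub>F n in sequentially. \<bar>G (x n)\<bar> < \<epsilon> / 2"
    using order_tendstoD(2)[OF tendsto_rabs_zero, of "\<lambda>n. G (x n)" sequentially "\<epsilon> / 2"] \<epsilon>
    by simp
  then obtain n where "\<And>m. n \<le> m \<Longrightarrow> \<bar>G (x m)\<bar> < \<epsilon> / 2"
    by (auto simp: eventually_sequentially)
  moreover have "n \<le> \<nu> (r (Suc n))"
    using r(2)[of n] seq_suble[OF \<open>strict_mono r\<close>, of n] by (simp add: R_def)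
  ultimately show False
    using hump[of n] by fastforce
qed

subsection \<open>Banach lattices\<close>

text \<open>Only one inequality is proved directly; the other is the same inequality for
  \<open>inverse c\<close>.\<close>

lemma abs_scaleR_lattice:
  fixes x :: "'a::banach_lattice"
  shows "\<bar>c *\<^sub>R x\<bar> = \<bar>c\<bar> *\<^sub>R \<bar>x\<bar>"
proof -
  have pos: "\<bar>c *\<^sub>R x\<bar> \<le> c *\<^sub>R \<bar>x\<bar>" if "0 \<le> c" for c and x :: 'a
  proof (rule abs_leI)
    show "c *\<^sub>R x \<le> c *\<^sub>R \<bar>x\<bar>"
      using that by (intro scaleR_left_mono abs_ge_self)
    have "c *\<^sub>R (- x) \<le> c *\<^sub>R \<bar>x\<bar>"
      using that by (intro scaleR_left_mono abs_ge_minus_self)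
    then show "- (c *\<^sub>R x) \<le> c *\<^sub>R \<bar>x\<bar>" by simp
  qed
  have le: "\<bar>c *\<^sub>R x\<bar> \<le> \<bar>c\<bar> *\<^sub>R \<bar>x\<bar>" for c and x :: 'a
    using pos[of c x] pos[of "- c" "- x"] by (cases "0 \<le> c") auto
  show ?thesis
  proof (cases "c = 0")
    case False
    have "\<bar>c\<bar> *\<^sub>R \<bar>x\<bar> \<le> \<bar>c\<bar> *\<^sub>R (\<bar>inverse c\<bar> *\<^sub>R \<bar>c *\<^sub>R x\<bar>)"
      using le[of "inverse c" "c *\<^sub>R x"] False by (intro scaleR_left_mono) auto
    then show ?thesis
      using False le[of c x] by (intro antisym) auto
  qed simp
qed

lemma norm_abs_lattice [simp]:
  fixes x :: "'a::banach_lattice"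
  shows "norm \<bar>x\<bar> = norm x"
  by (intro antisym norm_mono_abs) auto

text \<open>Both scalars are replaced by a common larger one, positive thanks to the summand 1,
  which can then be divided out.\<close>

lemma disjoint_scaleR:
  fixes a b :: "'a::banach_lattice"
  assumes "inf a b = 0" "0 \<le> s" "0 \<le> t"
  shows "inf (s *\<^sub>R a) (t *\<^sub>R b) = 0"
proof -
  have ab: "0 \<le> a" "0 \<le> b"
    using assms(1) by (metis inf.cobounded1 inf.cobounded2)+
  define m where "m = s + t + 1"
  have m: "0 < m" "s \<le> m" "t \<le> m"
    using assms by (auto simp: m_def)
  let ?w = "inf (s *\<^sub>R a) (t *\<^sub>R b)"
  have "?w \<le> m *\<^sub>R a" "?w \<le> m *\<^sub>R b"
    using m ab by (auto intro: le_infI1 le_infI2 scaleR_right_mono)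
  then have "inverse m *\<^sub>R ?w \<le> inverse m *\<^sub>R m *\<^sub>R a" "inverse m *\<^sub>R ?w \<le> inverse m *\<^sub>R m *\<^sub>R b"
    using m by (intro scaleR_left_mono; simp)+
  then have "inverse m *\<^sub>R ?w \<le> inf a b"
    using m by simp
  then have "m *\<^sub>R inverse m *\<^sub>R ?w \<le> m *\<^sub>R 0"
    using m assms(1) by (intro scaleR_left_mono) auto
  then show ?thesis
    using m assms ab by (intro antisym) (auto intro: scaleR_nonneg_nonneg)
qed

text \<open>Closedness of the cone comes from the monotone norm: the negative part of
  \<open>l\<close> is dominated by \<open>|X n - l|\<close>.\<close>

lemma LIMSEQ_nonneg_lattice:
  fixes X :: "nat \<Rightarrow> 'a::banach_lattice"
  assumes "X \<longlonglongrightarrow> l" "\<forall>\<^sub>F n in sequentially. 0 \<le> X n"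
  shows "0 \<le> l"
proof -
  let ?m = "sup (- l) 0"
  have "norm ?m \<le> norm (X n - l)" if "0 \<le> X n" for n
  proof (rule norm_mono_abs)
    have "- l \<le> X n - l" using that by simp
    also have "\<dots> \<le> \<bar>X n - l\<bar>" by (rule abs_ge_self)
    finally have "?m \<le> \<bar>X n - l\<bar>" by (rule le_supI) simp
    then show "\<bar>?m\<bar> \<le> \<bar>X n - l\<bar>"
      by (subst abs_of_nonneg) auto
  qed
  then have "\<forall>\<^sub>F n in sequentially. norm ?m \<le> norm (X n - l)"
    using assms(2) by (auto elim: eventually_mono)
  moreover have "(\<lambda>n. norm (X n - l)) \<longlonglongrightarrow> 0"
    using assms(1) by (simp add: LIM_zero tendsto_norm_zero)
  ultimately have "norm ?m \<le> 0"
    by (intro tendsto_lowerbound) auto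
  then have "?m = 0"
    by (simp only: norm_le_zero_iff)
  then have "- l \<le> 0"
    by (simp only: le_iff_sup)
  then show ?thesis by simp
qed

lemma term_le_suminf_lattice:
  fixes t :: "nat \<Rightarrow> 'a::banach_lattice"
  assumes "summable t" "\<And>n. 0 \<le> t n"
  shows "t k \<le> suminf t"
proof -
  have "0 \<le> sum t {..<n} - t k" if "Suc k \<le> n" for n
    using that assms(2) sum_mono2[of "{..<n}" "{k}" t] by simp
  then have "\<forall>\<^sub>F n in sequentially. 0 \<le> sum t {..<n} - t k"
    by (auto simp: eventually_sequentially)
  moreover have "(\<lambda>n. sum t {..<n} - t k) \<longlonglongrightarrow> suminf t - t k"
    using summable_LIMSEQ[OF assms(1)] by (intro tendsto_intros)
  ultimately have "0 \<le> suminf t - t k"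
    by (intro LIMSEQ_nonneg_lattice)
  then show ?thesis by simp
qed

text \<open>The signs of \<open>f (z i)\<close> turn the sum into the value of \<open>f\<close> at
  one signed sum, whose modulus disjointness keeps below \<open>|x|\<close>.\<close>

lemma sum_functional_disjoint_le:
  fixes f :: "'a::banach_lattice \<Rightarrow>\<^sub>L real" and z :: "nat \<Rightarrow> 'a"
  assumes disj: "\<And>i j. i < j \<Longrightarrow> j < n \<Longrightarrow> inf \<bar>z i\<bar> \<bar>z j\<bar> = 0"
    and le: "\<And>i. i < n \<Longrightarrow> \<bar>z i\<bar> \<le> \<bar>x\<bar>"
  shows "(\<Sum>i<n. \<bar>f (z i)\<bar>) \<le> norm f * norm x"
proof -
  let ?s = "\<Sum>i<n. sgn (f (z i)) *\<^sub>R z i"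
  have "(\<Sum>i<n. \<bar>f (z i)\<bar>) = f ?s"
    by (simp add: blinfun.sum_right blinfun.scaleR_right abs_sgn mult.commute)
  also have "\<dots> \<le> norm f * norm ?s"
    using norm_blinfun[of f ?s] by simp
  also have "norm ?s \<le> norm x"
  proof (rule norm_mono_abs)
    have "\<bar>?s\<bar> \<le> (\<Sum>i<n. \<bar>sgn (f (z i)) *\<^sub>R z i\<bar>)"
      by (rule sum_abs)
    also have "\<dots> \<le> (\<Sum>i<n. \<bar>z i\<bar>)"
    proof (rule sum_mono)
      fix i
      have "\<bar>sgn (f (z i))\<bar> *\<^sub>R \<bar>z i\<bar> \<le> 1 *\<^sub>R \<bar>z i\<bar>"
        by (rule scaleR_right_mono) (auto simp: sgn_if)
      then show "\<bar>sgn (f (z i)) *\<^sub>R z i\<bar> \<le> \<bar>z i\<bar>"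
        by (simp add: abs_scaleR_lattice)
    qed
    also have "\<dots> \<le> \<bar>x\<bar>"
      using disj le by (intro sum_disjoint_le) auto
    finally show "\<bar>?s\<bar> \<le> \<bar>x\<bar>" .
  qed
  finally show ?thesis
    by (simp add: mult_left_mono)
qed

section \<open>Two classes of disjointly weakly compact sets\<close>

lemma order_bounded_disjointly_weakly_compact:
  fixes A :: "'a::banach_lattice set"
  assumes "order_bounded A"
  shows "disjointly_weakly_compact A"
proof -
  obtain a b where A: "A \<subseteq> {a..b}"
    using assms by (auto simp: order_bounded_def)
  define u where "u = \<bar>a\<bar> + \<bar>b\<bar>"
  have "0 \<le> u" by (simp add: u_def)
  have le: "\<bar>x\<bar> \<le> \<bar>u\<bar>" if "x \<in> A" for x
    unfolding abs_of_nonneg[OF \<open>0 \<le> u\<close>]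
  proof (rule abs_leI)
    have x: "a \<le> x" "x \<le> b" using that A by auto
    have "x \<le> \<bar>b\<bar>" using x(2) abs_ge_self by (rule order.trans)
    then show "x \<le> u" by (simp add: u_def add_increasing)
    have "- x \<le> \<bar>a\<bar>"
      using x(1) abs_ge_minus_self[of a] by (meson neg_le_iff_le order.trans)
    then show "- x \<le> u" by (simp add: u_def add_increasing2)
  qed
  then have "bounded A"
    by (auto simp: bounded_iff intro!: norm_mono_abs)
  moreover have "weakly_null x" if x: "disjoint_seq x" "range x \<subseteq> Sol A" for x
    unfolding weakly_null_def
  proof
    fix f :: "'a \<Rightarrow>\<^sub>L real"
    have "\<bar>x n\<bar> \<le> \<bar>u\<bar>" for n
    proof -
      have "x n \<in> Sol A" using x(2) by blast
      then obtain a where "a \<in> A" "\<bar>x n\<bar> \<le> \<bar>a\<bar>" by (auto simp: Sol_def)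
      then show ?thesis using le[of a] by (meson order.trans)
    qed
    then have "(\<Sum>i<n. \<bar>f (x i)\<bar>) \<le> norm f * norm u" for n
      using x(1) by (intro sum_functional_disjoint_le) (auto simp: disjoint_seq_def)
    then have "summable (\<lambda>n. \<bar>f (x n)\<bar>)"
      by (intro summableI_nonneg_bounded) auto
    then show "(\<lambda>n. f (x n)) \<longlonglongrightarrow> 0"
      using summable_LIMSEQ_zero tendsto_rabs_zero_iff by blast
  qed
  ultimately show ?thesis
    by (auto simp: disjointly_weakly_compact_def)
qed

text \<open>The value at \<open>\<bar>x\<bar>\<close> of the restriction of \<open>\<bar>f\<bar>\<close> to the principal ideal of \<open>y\<close>.\<close>

definition ideal_seminorm :: "('a::banach_lattice \<Rightarrow>\<^sub>L real) \<Rightarrow> 'a \<Rightarrow> 'a \<Rightarrow> real" where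
  "ideal_seminorm f y x = (SUP z\<in>{z. \<bar>z\<bar> \<le> \<bar>x\<bar> \<and> (\<exists>m\<ge>0. \<bar>z\<bar> \<le> m *\<^sub>R \<bar>y\<bar>)}. \<bar>f z\<bar>)"

lemma ideal_seminorm_upper:
  fixes f :: "'a::banach_lattice \<Rightarrow>\<^sub>L real"
  assumes "\<bar>z\<bar> \<le> \<bar>x\<bar>" "0 \<le> m" "\<bar>z\<bar> \<le> m *\<^sub>R \<bar>y\<bar>"
  shows "\<bar>f z\<bar> \<le> ideal_seminorm f y x"
  unfolding ideal_seminorm_def
proof (rule cSUP_upper)
  show "bdd_above ((\<lambda>z. \<bar>f z\<bar>) ` {z. \<bar>z\<bar> \<le> \<bar>x\<bar> \<and> (\<exists>m\<ge>0. \<bar>z\<bar> \<le> m *\<^sub>R \<bar>y\<bar>)})"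
  proof (rule bdd_aboveI2)
    fix z assume "z \<in> {z. \<bar>z\<bar> \<le> \<bar>x\<bar> \<and> (\<exists>m\<ge>0. \<bar>z\<bar> \<le> m *\<^sub>R \<bar>y\<bar>)}"
    then have "norm f * norm z \<le> norm f * norm x"
      by (auto intro!: mult_left_mono norm_mono_abs)
    then show "\<bar>f z\<bar> \<le> norm f * norm x"
      using norm_blinfun[of f z] by simp
  qed
qed (use assms in auto)

lemma ideal_seminorm_least:
  fixes f :: "'a::banach_lattice \<Rightarrow>\<^sub>L real"
  assumes "\<And>z m. \<bar>z\<bar> \<le> \<bar>x\<bar> \<Longrightarrow> 0 \<le> m \<Longrightarrow> \<bar>z\<bar> \<le> m *\<^sub>R \<bar>y\<bar> \<Longrightarrow> \<bar>f z\<bar> \<le> c"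
  shows "ideal_seminorm f y x \<le> c"
  unfolding ideal_seminorm_def using assms by (intro cSUP_least) (auto intro!: exI[of _ 0])

lemma ideal_seminorm_minus: "ideal_seminorm f y (- x) = ideal_seminorm f y x"
  by (simp add: ideal_seminorm_def)

lemma ideal_seminorm_le: "ideal_seminorm f y x \<le> norm f * norm x"
proof (rule ideal_seminorm_least)
  fix z assume "\<bar>z\<bar> \<le> \<bar>x\<bar>"
  then have "norm f * norm z \<le> norm f * norm x"
    by (intro mult_left_mono norm_mono_abs) auto
  then show "\<bar>f z\<bar> \<le> norm f * norm x"
    using norm_blinfun[of f z] by simp
qed

text \<open>Subadditivity is Riesz decomposition; the parts have modulus at most \<open>|z|\<close>,
  so they stay in the ideal of \<open>y\<close> with the same \<open>m\<close>.\<close>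

lemma sublinear_ideal_seminorm: "sublinear (ideal_seminorm f y)"
proof (rule sublinearI)
  show "ideal_seminorm f y 0 \<le> 0"
    using ideal_seminorm_le[of f y 0] by simp
  fix x x' :: 'a
  show "ideal_seminorm f y (x + x') \<le> ideal_seminorm f y x + ideal_seminorm f y x'"
  proof (rule ideal_seminorm_least)
    fix z m assume z: "\<bar>z\<bar> \<le> \<bar>x + x'\<bar>" "0 \<le> m" "\<bar>z\<bar> \<le> m *\<^sub>R \<bar>y\<bar>"
    have "\<bar>z\<bar> \<le> \<bar>x\<bar> + \<bar>x'\<bar>"
      using z(1) abs_triangle_ineq by (rule order.trans)
    then obtain a b where ab: "z = a + b" "\<bar>a\<bar> \<le> \<bar>x\<bar>" "\<bar>b\<bar> \<le> \<bar>x'\<bar>" "\<bar>a\<bar> \<le> \<bar>z\<bar>" "\<bar>b\<bar> \<le> \<bar>z\<bar>"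
      using Riesz_decomposition[of "\<bar>x\<bar>" "\<bar>x'\<bar>" z] by auto
    have "\<bar>f a\<bar> \<le> ideal_seminorm f y x"
      using ab(2) z(2) order.trans[OF ab(4) z(3)] by (rule ideal_seminorm_upper)
    moreover have "\<bar>f b\<bar> \<le> ideal_seminorm f y x'"
      using ab(3) z(2) order.trans[OF ab(5) z(3)] by (rule ideal_seminorm_upper)
    ultimately show "\<bar>f z\<bar> \<le> ideal_seminorm f y x + ideal_seminorm f y x'"
      by (simp add: ab(1) blinfun.add_right)
  qed
next
  fix c :: real and x :: 'a assume c: "0 < c"
  show "ideal_seminorm f y (c *\<^sub>R x) \<le> c * ideal_seminorm f y x"
  proof (rule ideal_seminorm_least)
    fix z m assume z: "\<bar>z\<bar> \<le> \<bar>c *\<^sub>R x\<bar>" "0 \<le> m" "\<bar>z\<bar> \<le> m *\<^sub>R \<bar>y\<bar>"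
    have "inverse c *\<^sub>R \<bar>z\<bar> \<le> inverse c *\<^sub>R \<bar>c *\<^sub>R x\<bar>" "inverse c *\<^sub>R \<bar>z\<bar> \<le> inverse c *\<^sub>R m *\<^sub>R \<bar>y\<bar>"
      by (rule scaleR_left_mono; use z c in simp)+
    then have "\<bar>f (inverse c *\<^sub>R z)\<bar> \<le> ideal_seminorm f y x"
      using c z(2) by (intro ideal_seminorm_upper[of _ _ "inverse c * m"]) (auto simp: abs_scaleR_lattice)
    then show "\<bar>f z\<bar> \<le> c * ideal_seminorm f y x"
      using c by (simp add: blinfun.scaleR_right abs_mult field_simps)
  qed
qed

text \<open>Near-maximizers taken from the ideals of disjoint elements are disjoint and dominated by
  \<open>|x|\<close>.\<close>

lemma sum_ideal_seminorm_le:
  assumes "disjoint_seq y"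
  shows "(\<Sum>k<n. ideal_seminorm f (y k) x) \<le> norm f * norm x"
proof (rule field_le_epsilon)
  fix e :: real assume "0 < e"
  define \<delta> where "\<delta> = e / (real n + 1)"
  have \<delta>: "0 < \<delta>" "real n * \<delta> \<le> e"
    using \<open>0 < e\<close> by (auto simp: \<delta>_def field_simps)
  have "\<exists>z m. \<bar>z\<bar> \<le> \<bar>x\<bar> \<and> 0 \<le> m \<and> \<bar>z\<bar> \<le> m *\<^sub>R \<bar>y k\<bar> \<and> ideal_seminorm f (y k) x - \<delta> \<le> \<bar>f z\<bar>" for k
  proof (rule ccontr)
    assume "\<not> ?thesis"
    then have "ideal_seminorm f (y k) x \<le> ideal_seminorm f (y k) x - \<delta>"
      by (intro ideal_seminorm_least) (metis linear)
    then show False using \<delta>(1) by simp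
  qed
  then obtain z m where z: "\<And>k. \<bar>z k\<bar> \<le> \<bar>x\<bar>" "\<And>k. 0 \<le> m k" "\<And>k. \<bar>z k\<bar> \<le> m k *\<^sub>R \<bar>y k\<bar>"
    "\<And>k. ideal_seminorm f (y k) x - \<delta> \<le> \<bar>f (z k)\<bar>"
    by metis
  have "inf \<bar>z i\<bar> \<bar>z j\<bar> = 0" if "i < j" for i j
  proof (rule antisym)
    have "inf \<bar>z i\<bar> \<bar>z j\<bar> \<le> inf (m i *\<^sub>R \<bar>y i\<bar>) (m j *\<^sub>R \<bar>y j\<bar>)"
      by (rule inf_mono[OF z(3) z(3)])
    also have "\<dots> = 0"
      using assms that z(2) by (intro disjoint_scaleR) (auto simp: disjoint_seq_def)
    finally show "inf \<bar>z i\<bar> \<bar>z j\<bar> \<le> 0" .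
  qed simp
  then have "(\<Sum>k<n. \<bar>f (z k)\<bar>) \<le> norm f * norm x"
    using z(1) by (intro sum_functional_disjoint_le) auto
  moreover have "(\<Sum>k<n. ideal_seminorm f (y k) x - \<delta>) \<le> (\<Sum>k<n. \<bar>f (z k)\<bar>)"
    by (rule sum_mono[OF z(4)])
  ultimately show "(\<Sum>k<n. ideal_seminorm f (y k) x) \<le> norm f * norm x + e"
    using \<delta>(2) by (simp add: sum_subtractf)
qed

lemma weakly_null_disjointly_weakly_compact:
  fixes x :: "nat \<Rightarrow> 'a::banach_lattice"
  assumes "weakly_null x"
  shows "disjointly_weakly_compact (range x)"
proof -
  have "weakly_null y" if y: "disjoint_seq y" "range y \<subseteq> Sol (range x)" for y
    unfolding weakly_null_def
  proof
    fix f :: "'a \<Rightarrow>\<^sub>L real"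
    have "\<forall>k. \<exists>n. \<bar>y k\<bar> \<le> \<bar>x n\<bar>"
      using y(2) by (fastforce simp: Sol_def)
    then obtain \<nu> where \<nu>: "\<And>k. \<bar>y k\<bar> \<le> \<bar>x (\<nu> k)\<bar>"
      by metis
    let ?q = "\<lambda>k. ideal_seminorm f (y k)"
    have "\<exists>g :: 'a \<Rightarrow>\<^sub>L real. (\<forall>z. \<bar>g z\<bar> \<le> ?q k z) \<and> g (x (\<nu> k)) = ?q k (x (\<nu> k))" for k
      using Hahn_Banach_seminorm[OF sublinear_ideal_seminorm ideal_seminorm_minus ideal_seminorm_le,
          of f "y k" "x (\<nu> k)"] by metis
    then obtain g :: "nat \<Rightarrow> 'a \<Rightarrow>\<^sub>L real"
      where g: "\<And>k z. \<bar>g k z\<bar> \<le> ?q k z" "\<And>k. g k (x (\<nu> k)) = ?q k (x (\<nu> k))"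
      by metis
    have "(\<Sum>k<n. \<bar>g k z\<bar>) \<le> norm f * norm z" for n z
      using sum_mono[OF g(1)] sum_ideal_seminorm_le[OF y(1)] by (rule order.trans)
    then have lim: "(\<lambda>k. g k (x (\<nu> k))) \<longlonglongrightarrow> 0"
      using assms by (intro gliding_hump)
    \<comment> \<open>\<open>y k\<close> itself, with \<open>m = 1\<close>, competes in the supremum
      defining \<open>?q k\<close> at \<open>x (\<nu> k)\<close>.\<close>
    have "norm (f (y k)) \<le> g k (x (\<nu> k))" for k
      using ideal_seminorm_upper[OF \<nu>, of 1 k "y k"] by (simp add: g(2))
    then show "(\<lambda>k. f (y k)) \<longlonglongrightarrow> 0"
      by (intro Lim_null_comparison[OF _ lim] always_eventually allI)
  qed
  then show ?thesis
    using weakly_null_bounded[OF assms] by (simp add: disjointly_weakly_compact_def)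
qed

text \<open>Replaces the extended real supremum by a uniform \<epsilon> bound; the bound is not
  strict, since a supremum preserves only such bounds.\<close>

lemma limited_set_iff:
  "limited_set A \<longleftrightarrow> bounded A \<and>
    (\<forall>f \<epsilon>. weak_star_null f \<longrightarrow> 0 < \<epsilon> \<longrightarrow> (\<forall>\<^sub>F n in sequentially. \<forall>x\<in>A. \<bar>blinfun_apply (f n) x\<bar> \<le> \<epsilon>))"
proof -
  have "(\<lambda>n. SUP x\<in>A. ennreal \<bar>blinfun_apply (f n) x\<bar>) \<longlonglongrightarrow> 0 \<longleftrightarrow>
      (\<forall>\<epsilon>>0. \<forall>\<^sub>F n in sequentially. \<forall>x\<in>A. \<bar>blinfun_apply (f n) x\<bar> \<le> \<epsilon>)"
    (is "?S \<longlonglongrightarrow> 0 \<longleftrightarrow> ?R") for f :: "nat \<Rightarrow> 'a \<Rightarrow>\<^sub>L real"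
  proof
    assume S: "?S \<longlonglongrightarrow> 0"
    show ?R
    proof (intro allI impI)
      fix \<epsilon> :: real assume "0 < \<epsilon>"
      then have "\<forall>\<^sub>F n in sequentially. ?S n < ennreal \<epsilon>"
        by (intro order_tendstoD(2)[OF S]) auto
      then show "\<forall>\<^sub>F n in sequentially. \<forall>x\<in>A. \<bar>f n x\<bar> \<le> \<epsilon>"
      proof eventually_elim
        case (elim n)
        show ?case
        proof
          fix x assume "x \<in> A"
          then have "ennreal \<bar>f n x\<bar> \<le> ?S n"
            by (rule SUP_upper)
          then have "ennreal \<bar>f n x\<bar> \<le> ennreal \<epsilon>"
            using elim by simp
          then show "\<bar>f n x\<bar> \<le> \<epsilon>"
            using \<open>0 < \<epsilon>\<close> by (simp add: ennreal_le_iff)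
        qed
      qed
    qed
  next
    assume R: ?R
    show "?S \<longlonglongrightarrow> 0"
    proof (rule order_tendstoI)
      fix a :: ennreal assume "0 < a"
      \<comment> \<open>Being strictly below \<open>a\<close>, the element \<open>b\<close> is
        finite even if \<open>a\<close> is infinite.\<close>
      then obtain b where "0 < b" "b < a"
        using dense by blast
      then obtain \<epsilon> where \<epsilon>: "0 < \<epsilon>" "ennreal \<epsilon> < a"
        by (cases b) auto
      from R \<epsilon>(1) have "\<forall>\<^sub>F n in sequentially. \<forall>x\<in>A. \<bar>f n x\<bar> \<le> \<epsilon>"
        by blast
      then show "\<forall>\<^sub>F n in sequentially. ?S n < a"
      proof eventually_elim
        case (elim n)
        then have "?S n \<le> ennreal \<epsilon>"
          by (intro SUP_least ennreal_leI) auto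
        then show ?case using \<epsilon>(2) by simp
      qed
    qed simp
  qed
  then show ?thesis
    unfolding limited_set_def by blast
qed

subsection \<open>Disjointification\<close>

text \<open>The first positive part is at most \<open>inverse t\<close> times that of
  \<open>t p - q\<close>, which is disjoint from that of \<open>q - t p\<close>.\<close>

lemma scaled_pos_parts_disjoint:
  fixes p q :: "'a::banach_lattice"
  assumes "0 < t"
  shows "inf (sup (p - inverse t *\<^sub>R q) 0) (sup (q - t *\<^sub>R p) 0) = 0"
proof (rule antisym)
  have "p - inverse t *\<^sub>R q = inverse t *\<^sub>R (t *\<^sub>R p - q)"
    using assms by (simp add: algebra_simps)
  also have "\<dots> \<le> inverse t *\<^sub>R sup (t *\<^sub>R p - q) 0"
    using assms by (intro scaleR_left_mono) auto
  finally have "sup (p - inverse t *\<^sub>R q) 0 \<le> inverse t *\<^sub>R sup (t *\<^sub>R p - q) 0"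
    using assms by (auto intro!: scaleR_nonneg_nonneg)
  then have "inf (sup (p - inverse t *\<^sub>R q) 0) (sup (q - t *\<^sub>R p) 0)
      \<le> inf (inverse t *\<^sub>R sup (t *\<^sub>R p - q) 0) (1 *\<^sub>R sup (q - t *\<^sub>R p) 0)"
    by (intro inf_mono) auto
  also have "\<dots> = 0"
    using assms by (intro disjoint_scaleR pos_part_neg_part_disjoint) auto
  finally show "inf (sup (p - inverse t *\<^sub>R q) 0) (sup (q - t *\<^sub>R p) 0) \<le> 0" .
qed simp

text \<open>If the conclusion fails along \<open>x n \<in> A\<close>, pass to a sparse subsequence and subtract from
  \<open>\<bar>x (r (Suc k))\<bar>\<close> a large multiple of all its predecessors and a small multiple of
  \<open>s = (\<Sum>k. 2\<^sup>-\<^sup>k \<bar>x (r k)\<bar>)\<close>. The positive parts of the differences are disjoint, and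
  the functionals are small on what has been subtracted.\<close>

lemma disjointly_weakly_compact_uniformly_null:
  fixes \<phi> :: "nat \<Rightarrow> 'a::banach_lattice \<Rightarrow>\<^sub>L real"
  assumes A: "disjointly_weakly_compact A"
    and order: "\<And>u \<epsilon>. 0 < \<epsilon> \<Longrightarrow> \<forall>\<^sub>F n in sequentially. \<forall>z. \<bar>z\<bar> \<le> u \<longrightarrow> \<bar>\<phi> n z\<bar> \<le> \<epsilon>"
    and weak: "\<And>r z. strict_mono r \<Longrightarrow> weakly_null z \<Longrightarrow> (\<lambda>k. \<phi> (r k) (z k)) \<longlonglongrightarrow> 0"
    and "0 < \<epsilon>"
  shows "\<forall>\<^sub>F n in sequentially. \<forall>x\<in>A. \<bar>\<phi> n x\<bar> \<le> \<epsilon>"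
proof (rule ccontr)
  assume neg: "\<not> ?thesis"
  then have "A \<noteq> {}" by auto
  \<comment> \<open>\<open>x n\<close> violates the bound whenever some element of \<open>A\<close>
    does, and is arbitrary in \<open>A\<close> otherwise.\<close>
  then have "\<forall>n. \<exists>x\<in>A. (\<exists>x\<in>A. \<epsilon> < \<bar>\<phi> n x\<bar>) \<longrightarrow> \<epsilon> < \<bar>\<phi> n x\<bar>"
    by blast
  then obtain x where x: "\<And>n. x n \<in> A" "\<And>n. \<exists>x\<in>A. \<epsilon> < \<bar>\<phi> n x\<bar> \<Longrightarrow> \<epsilon> < \<bar>\<phi> n (x n)\<bar>"
    by metis
  have often: "\<exists>n\<ge>N. \<epsilon> < \<bar>\<phi> n (x n)\<bar>" for N
    using neg x(2) unfolding eventually_sequentially by (metis not_le)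
  define W where "W N = (\<Sum>i\<le>N. \<bar>x i\<bar>)" for N
  define R where "R N n \<longleftrightarrow> N < n \<and> (\<forall>z. \<bar>z\<bar> \<le> 4 ^ N *\<^sub>R W N \<longrightarrow> \<bar>\<phi> n z\<bar> \<le> 1 / real (Suc N))" for N n
  have step: "\<exists>n. \<epsilon> < \<bar>\<phi> n (x n)\<bar> \<and> R N n" for N
  proof -
    obtain M where M: "\<And>n z. M \<le> n \<Longrightarrow> \<bar>z\<bar> \<le> 4 ^ N *\<^sub>R W N \<Longrightarrow> \<bar>\<phi> n z\<bar> \<le> 1 / real (Suc N)"
      using order[of "1 / real (Suc N)" "4 ^ N *\<^sub>R W N"] by (auto simp: eventually_sequentially)
    obtain n where "max M (Suc N) \<le> n" "\<epsilon> < \<bar>\<phi> n (x n)\<bar>"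
      using often by blast
    then show ?thesis
      using M by (auto simp: R_def intro!: exI[of _ n])
  qed
  have "\<exists>r. \<forall>k. \<epsilon> < \<bar>\<phi> (r k) (x (r k))\<bar> \<and> R (r k) (r (Suc k))"
    by (rule dependent_nat_choice) (use step in blast)+
  then obtain r where r: "\<And>k. \<epsilon> < \<bar>\<phi> (r k) (x (r k))\<bar>" "\<And>k. R (r k) (r (Suc k))"
    by blast
  have mono: "strict_mono r"
    using r(2) by (simp add: strict_mono_Suc_iff R_def)
  have mono': "strict_mono (\<lambda>k. r (Suc k))"
    using mono by (simp add: strict_mono_def)

  define t where "t k = (1 / 2) ^ k *\<^sub>R \<bar>x (r k)\<bar>" for k
  define s where "s = suminf t"
  obtain B where B: "\<And>y. y \<in> A \<Longrightarrow> norm y \<le> B"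
    using A by (auto simp: disjointly_weakly_compact_def bounded_iff)
  have t: "summable t"
  proof (rule summable_comparison_test)
    show "\<exists>N. \<forall>n\<ge>N. norm (t n) \<le> (1 / 2) ^ n * B"
      using B x(1) by (auto simp: t_def intro!: mult_left_mono)
    show "summable (\<lambda>n. (1 / 2) ^ n * B)"
      by (intro summable_mult2 summable_geometric) auto
  qed
  have t_nonneg: "0 \<le> t k" for k
    by (simp add: t_def scaleR_nonneg_nonneg)
  have t_le: "t k \<le> s" for k
    unfolding s_def using t t_nonneg by (rule term_le_suminf_lattice)
  have s: "0 \<le> s"
    using t_nonneg t_le by (rule order.trans)
  have W: "0 \<le> W N" for N
    by (simp add: W_def sum_nonneg)

  let ?p = "\<lambda>k. \<bar>x (r (Suc k))\<bar>"
  \<comment> \<open>The vectors \<open>x (r j)\<close> with \<open>j \<le> k\<close> are among those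
    summed in \<open>W (r k)\<close>; by \<open>R\<close>, the functional at
    \<open>r (Suc k)\<close> is small on the interval given by \<open>v k\<close>.\<close>
  define v where "v k = 4 ^ r k *\<^sub>R W (r k)" for k
  define w where "w k = (1 / 2) ^ k *\<^sub>R s" for k
  define u where "u k = sup (?p k - (v k + w k)) 0" for k
  have v: "0 \<le> v k" and w: "0 \<le> w k" and u: "0 \<le> u k" for k
    by (auto simp: v_def w_def u_def intro!: scaleR_nonneg_nonneg W s)
  have "\<exists>a b c. x (r (Suc k)) = a + (b + c) \<and> \<bar>a\<bar> \<le> u k \<and> \<bar>a\<bar> \<le> ?p k \<and> \<bar>b\<bar> \<le> v k \<and> \<bar>c\<bar> \<le> w k" for k
  proof -
    have "?p k - (v k + w k) \<le> u k"
      by (simp add: u_def)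
    then have "?p k \<le> u k + (v k + w k)"
      by (simp add: diff_le_eq)
    then obtain a d where ad: "x (r (Suc k)) = a + d" "\<bar>a\<bar> \<le> u k" "\<bar>d\<bar> \<le> v k + w k" "\<bar>a\<bar> \<le> ?p k"
      using Riesz_decomposition[OF u[of k] add_nonneg_nonneg[OF v[of k] w[of k]]] by metis
    obtain b c where "d = b + c" "\<bar>b\<bar> \<le> v k" "\<bar>c\<bar> \<le> w k"
      using Riesz_decomposition[OF v[of k] w[of k] ad(3)] by metis
    with ad show ?thesis by blast
  qed
  then obtain a b c where abc: "\<And>k. x (r (Suc k)) = a k + (b k + c k)"
    and a: "\<And>k. \<bar>a k\<bar> \<le> u k" "\<And>k. \<bar>a k\<bar> \<le> ?p k"
    and b: "\<And>k. \<bar>b k\<bar> \<le> v k" and c: "\<And>k. \<bar>c k\<bar> \<le> w k"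
    by metis

  \<comment> \<open>The disjointness is that of scaled positive parts with factor
    \<open>4 ^ k\<close>: \<open>v k\<close> contains that multiple of \<open>?p j\<close>, and
    \<open>w j\<close> contains its inverse multiple of \<open>?p k\<close>.\<close>
  have disj: "inf \<bar>a j\<bar> \<bar>a k\<bar> = 0" if "j < k" for j k
  proof (rule antisym)
    have "4 ^ k *\<^sub>R ?p j \<le> v k"
      unfolding v_def
    proof (rule scaleR_mono)
      show "(4::real) ^ k \<le> 4 ^ r k"
        using seq_suble[OF mono, of k] by (intro power_increasing) auto
      have "r (Suc j) \<le> r k"
        using mono that by (simp add: strict_mono_less_eq)
      then show "?p j \<le> W (r k)"
        unfolding W_def using sum_mono2[of "{..r k}" "{r (Suc j)}" "\<lambda>i. \<bar>x i\<bar>"] by simp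
    qed auto
    then have "?p k - (v k + w k) \<le> ?p k - 4 ^ k *\<^sub>R ?p j"
      using w by (intro diff_mono order.refl) (simp add: add_increasing2)
    then have uk: "u k \<le> sup (?p k - 4 ^ k *\<^sub>R ?p j) 0"
      unfolding u_def by (intro sup_mono order.refl)
    \<comment> \<open>From \<open>j < k\<close> follows \<open>j + Suc k \<le> k + k\<close>; the
      factor on the right is what \<open>w j\<close> retains of \<open>?p k\<close> through the
      series \<open>s\<close>.\<close>
    have "inverse (4 ^ k) *\<^sub>R ?p k \<le> ((1 / 2) ^ j * (1 / 2) ^ Suc k) *\<^sub>R ?p k"
    proof (rule scaleR_right_mono)
      have "inverse (4 ^ k) = ((1 / 2) :: real) ^ (k + k)"
        by (simp add: power_add field_simps flip: power_mult_distrib)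
      also have "\<dots> \<le> (1 / 2) ^ (j + Suc k)"
        using that by (intro power_decreasing) auto
      finally show "inverse (4 ^ k) \<le> ((1 / 2) :: real) ^ j * (1 / 2) ^ Suc k"
        by (simp add: power_add)
    qed simp
    also have "\<dots> = (1 / 2) ^ j *\<^sub>R t (Suc k)"
      by (simp add: t_def)
    also have "\<dots> \<le> w j"
      unfolding w_def by (intro scaleR_left_mono t_le) simp
    finally have "?p j - (v j + w j) \<le> ?p j - inverse (4 ^ k) *\<^sub>R ?p k"
      using v by (intro diff_mono order.refl) (simp add: add_increasing)
    then have uj: "u j \<le> sup (?p j - inverse (4 ^ k) *\<^sub>R ?p k) 0"
      unfolding u_def by (intro sup_mono order.refl)
    have "inf \<bar>a j\<bar> \<bar>a k\<bar> \<le> inf (sup (?p j - inverse (4 ^ k) *\<^sub>R ?p k) 0) (sup (?p k - 4 ^ k *\<^sub>R ?p j) 0)"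
      by (intro inf_mono order.trans[OF a(1) uj] order.trans[OF a(1) uk])
    also have "\<dots> = 0"
      by (rule scaled_pos_parts_disjoint) simp
    finally show "inf \<bar>a j\<bar> \<bar>a k\<bar> \<le> 0" .
  qed simp
  have "disjoint_seq a"
    unfolding disjoint_seq_def using disj by (metis inf_commute linorder_neqE_nat)
  moreover have "range a \<subseteq> Sol A"
    using a(2) x(1) by (auto simp: Sol_def)
  ultimately have "weakly_null a"
    using A by (simp add: disjointly_weakly_compact_def)
  then have "(\<lambda>k. \<phi> (r (Suc k)) (a k)) \<longlonglongrightarrow> 0"
    by (rule weak[OF mono'])
  then have "\<forall>\<^sub>F k in sequentially. \<bar>\<phi> (r (Suc k)) (a k)\<bar> < \<epsilon> / 3"
    using \<open>0 < \<epsilon>\<close> by (intro order_tendstoD(2)[OF tendsto_rabs_zero]) auto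
  moreover have "\<forall>\<^sub>F k in sequentially. 1 / real (Suc (r k)) < \<epsilon> / 3"
  proof -
    have "(\<lambda>n. 1 / real (Suc n)) \<longlonglongrightarrow> 0"
      using LIMSEQ_inverse_real_of_nat by (simp add: inverse_eq_divide)
    then have "(\<lambda>k. 1 / real (Suc (r k))) \<longlonglongrightarrow> 0"
      using LIMSEQ_subseq_LIMSEQ[OF _ mono, of "\<lambda>n. 1 / real (Suc n)" 0] by (simp add: o_def)
    then show ?thesis
      using \<open>0 < \<epsilon>\<close> by (intro order_tendstoD(2)) auto
  qed
  moreover have "\<forall>\<^sub>F k in sequentially. \<forall>z. \<bar>z\<bar> \<le> s \<longrightarrow> \<bar>\<phi> (r (Suc k)) z\<bar> \<le> \<epsilon> / 3"
    using order[of "\<epsilon> / 3" s] \<open>0 < \<epsilon>\<close> by (intro eventually_subseq[OF mono']) auto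
  ultimately have "\<forall>\<^sub>F k in sequentially. False"
  proof eventually_elim
    case (elim k)
    \<comment> \<open>\<open>b k\<close> is controlled by the choice of \<open>r (Suc k)\<close>,
      and \<open>c k\<close> by the fixed order interval of \<open>s\<close>, since
      \<open>|c k| \<le> w k \<le> s\<close>.\<close>
    have "\<bar>\<phi> (r (Suc k)) (b k)\<bar> \<le> 1 / real (Suc (r k))"
      using r(2)[of k] b[of k] by (simp add: R_def v_def)
    moreover have "w k \<le> 1 *\<^sub>R s"
      unfolding w_def by (intro scaleR_right_mono s) (simp add: power_le_one)
    then have "\<bar>\<phi> (r (Suc k)) (c k)\<bar> \<le> \<epsilon> / 3"
      using elim(3) order.trans[OF c] by simp
    ultimately have "\<bar>\<phi> (r (Suc k)) (x (r (Suc k)))\<bar> < \<epsilon>"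
      using elim(1,2) unfolding abc blinfun.add_right by linarith
    then show ?case using r(1)[of "Suc k"] by simp
  qed
  then show False by simp
qed

section \<open>The two implications for operators\<close>

theorem theorem2p13:
  fixes T :: "'e::banach_lattice \<Rightarrow>\<^sub>L 'x::banach"
  shows "DW_limited T \<longleftrightarrow> weak_star_Dunford_Pettis T \<and> order_limited T"
proof (intro iffI conjI)
  assume DW: "DW_limited T"
  then show "order_limited T"
    by (simp add: DW_limited_def order_limited_def order_bounded_disjointly_weakly_compact)
  show "weak_star_Dunford_Pettis T"
    unfolding weak_star_Dunford_Pettis_def
  proof (intro allI impI, elim conjE)
    fix x :: "nat \<Rightarrow> 'e" and f :: "nat \<Rightarrow> 'x \<Rightarrow>\<^sub>L real"
    assume "weakly_null x" and f: "weak_star_null f"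
    \<comment> \<open>The resulting bound is uniform over the whole range, so it covers the pairing
      of \<open>f n\<close> with \<open>T (x n)\<close>.\<close>
    then have lim: "limited_set (T ` range x)"
      using DW by (simp add: DW_limited_def weakly_null_disjointly_weakly_compact)
    show "(\<lambda>n. f n (T (x n))) \<longlonglongrightarrow> 0"
      unfolding tendsto_iff
    proof (intro allI impI)
      fix e :: real assume "0 < e"
      then have "\<forall>\<^sub>F n in sequentially. \<forall>y\<in>T ` range x. \<bar>f n y\<bar> \<le> e / 2"
        using lim[unfolded limited_set_iff, THEN conjunct2, rule_format, OF f, of "e / 2"] by simp
      then show "\<forall>\<^sub>F n in sequentially. dist (f n (T (x n))) 0 < e"
      proof eventually_elim
        case (elim n)
        then have "\<bar>f n (T (x n))\<bar> \<le> e / 2" by blast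
        then show ?case using \<open>0 < e\<close> by simp
      qed
    qed
  qed
next
  assume "weak_star_Dunford_Pettis T \<and> order_limited T"
  then have DP: "weak_star_Dunford_Pettis T" and OL: "order_limited T" by auto
  show "DW_limited T"
    unfolding DW_limited_def limited_set_iff
  proof (intro allI impI conjI)
    fix A :: "'e set" assume A: "disjointly_weakly_compact A"
    then show "bounded (T ` A)"
      by (intro bounded_linear_image blinfun.bounded_linear_right)
        (simp add: disjointly_weakly_compact_def)
    fix f :: "nat \<Rightarrow> 'x \<Rightarrow>\<^sub>L real" and \<epsilon> :: real
    assume f: "weak_star_null f" and "0 < \<epsilon>"
    have "\<forall>\<^sub>F n in sequentially. \<forall>x\<in>A. \<bar>(f n o\<^sub>L T) x\<bar> \<le> \<epsilon>"
    \<comment> \<open>Order limitedness supplies smallness on order intervals, the weak*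
      Dunford-Pettis property supplies smallness along weakly null sequences.\<close>
    proof (rule disjointly_weakly_compact_uniformly_null[OF A _ _ \<open>0 < \<epsilon>\<close>])
      fix u :: 'e and \<epsilon> :: real assume "0 < \<epsilon>"
      have "order_bounded {- u..u}"
        by (auto simp: order_bounded_def)
      then have "\<forall>\<^sub>F n in sequentially. \<forall>y\<in>T ` {- u..u}. \<bar>f n y\<bar> \<le> \<epsilon>"
        using OL[unfolded order_limited_def limited_set_iff] f \<open>0 < \<epsilon>\<close> by blast
      then show "\<forall>\<^sub>F n in sequentially. \<forall>z. \<bar>z\<bar> \<le> u \<longrightarrow> \<bar>(f n o\<^sub>L T) z\<bar> \<le> \<epsilon>"
      proof eventually_elim
        case (elim n)
        have "z \<in> {- u..u}" if "\<bar>z\<bar> \<le> u" for z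
          using abs_le_D1[OF that] abs_le_D2[OF that] by (simp add: minus_le_iff)
        then show ?case using elim by simp
      qed
    next
      fix r :: "nat \<Rightarrow> nat" and z :: "nat \<Rightarrow> 'e"
      assume "strict_mono r" and z: "weakly_null z"
      \<comment> \<open>The weakly null sequence is paired with a subsequence of the functionals,
        which is again weak* null.\<close>
      have f_r: "weak_star_null (\<lambda>k. f (r k))"
        unfolding weak_star_null_def
      proof
        fix y
        show "(\<lambda>k. f (r k) y) \<longlonglongrightarrow> 0"
          using LIMSEQ_subseq_LIMSEQ[OF _ \<open>strict_mono r\<close>, of "\<lambda>n. f n y" 0] f
          by (simp add: weak_star_null_def o_def)
      qed
      have "(\<lambda>k. f (r k) (T (z k))) \<longlonglongrightarrow> 0"
        using DP[unfolded weak_star_Dunford_Pettis_def, rule_format, OF conjI, OF z f_r] .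
      then show "(\<lambda>k. (f (r k) o\<^sub>L T) (z k)) \<longlonglongrightarrow> 0"
        by simp
    qed
    then show "\<forall>\<^sub>F n in sequentially. \<forall>y\<in>T ` A. \<bar>f n y\<bar> \<le> \<epsilon>"
      by simp
  qed
qed

end
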